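(* The infinite words $f(h^\omega(0))$ and $f(g(h^\omega(0)))$ are rich.
   Context: Morphisms: $f:\{0,1,2\}^*\to\{0,1\}^*$, $f(0)=0$, $f(1)=01$, $f(2)=011$; $g,h:\{0,1,2\}^*\to\{0,1,2\}^*$, $g(0)=011$, $g(1)=0121$, $g(2)=012121$, $h(0)=01$, $h(1)=02$, $h(2)=022$. $h^\omega(0)=\lim_n h^n(0)$ is the infinite fixed point of $h$ starting with $0$. A finite word of length $n$ is rich if it has $n$ distinct nonempty palindromic factors; an infinite word is rich if all of its finite factors are rich. *)

theory Defs
  imports "HOL-Library.Stream" "HOL-Library.Sublist"
begin

datatype bin = B0 | B1

datatype tern = T0 | T1 | T2

primrec f_letter :: "tern \<Rightarrow> bin list" where
  "f_letter T0 = [B0]"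
| "f_letter T1 = [B0, B1]"
| "f_letter T2 = [B0, B1, B1]"

primrec g_letter :: "tern \<Rightarrow> tern list" where
  "g_letter T0 = [T0, T1, T1]"
| "g_letter T1 = [T0, T1, T2, T1]"
| "g_letter T2 = [T0, T1, T2, T1, T2, T1]"

primrec h_letter :: "tern \<Rightarrow> tern list" where
  "h_letter T0 = [T0, T1]"
| "h_letter T1 = [T0, T2]"
| "h_letter T2 = [T0, T2, T2]"

text \<open>A morphism of free monoids is given by its values on letters.\<close>

definition morph :: "('a \<Rightarrow> 'b list) \<Rightarrow> 'a list \<Rightarrow> 'b list" where
  "morph \<phi> w = concat (map \<phi> w)"

text \<open>The infinite concatenation \<^const>\<open>flat\<close> is meaningful only when all blocks are nonempty,
  so \<open>morph_inf\<close> is to be used for non-erasing morphisms only.\<close>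

definition morph_inf :: "('a \<Rightarrow> 'b list) \<Rightarrow> 'a stream \<Rightarrow> 'b stream" where
  "morph_inf \<phi> x = flat (smap \<phi> x)"

lemma letters_nonempty: "f_letter a \<noteq> []" "g_letter a \<noteq> []" "h_letter a \<noteq> []"
  by (cases a; simp)+

definition word_tendsto :: "(nat \<Rightarrow> 'a list) \<Rightarrow> 'a stream \<Rightarrow> bool" where
  "word_tendsto u x \<longleftrightarrow> (\<forall>k. \<exists>N. \<forall>n\<ge>N. prefix (stake k x) (u n))"

definition word_lim :: "(nat \<Rightarrow> 'a list) \<Rightarrow> 'a stream" where
  "word_lim u = (THE x. word_tendsto u x)"

definition h_omega :: "tern stream" where
  "h_omega = word_lim (\<lambda>n. (morph h_letter ^^ n) [T0])"

definition palindrome :: "'a list \<Rightarrow> bool" where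
  "palindrome w \<longleftrightarrow> rev w = w"

definition rich :: "'a list \<Rightarrow> bool" where
  "rich w \<longleftrightarrow> card {v. v \<noteq> [] \<and> palindrome v \<and> sublist v w} = length w"

definition factor_inf :: "'a list \<Rightarrow> 'a stream \<Rightarrow> bool" where
  "factor_inf w x \<longleftrightarrow> (\<exists>i n. w = stake n (sdrop i x))"

definition rich_inf :: "'a stream \<Rightarrow> bool" where
  "rich_inf x \<longleftrightarrow> (\<forall>w. factor_inf w x \<longrightarrow> rich w)"

text \<open>The limit defining \<^const>\<open>h_omega\<close> exists and is unique.\<close>

lemma word_tendsto_unique:
  assumes "word_tendsto u x" "word_tendsto u y"
  shows "x = y"
proof -
  have "stake k x = stake k y" for k
  proof -
    obtain N M where "\<forall>n\<ge>N. prefix (stake k x) (u n)" "\<forall>n\<ge>M. prefix (stake k y) (u n)"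
      using assms unfolding word_tendsto_def by meson
    hence "prefix (stake k x) (u (max N M))" "prefix (stake k y) (u (max N M))"
      by simp_all
    thus ?thesis
      by (metis length_stake prefix_length_prefix prefix_order.antisym order_refl)
  qed
  hence "x !! k = y !! k" for k
    by (metis stake_nth lessI)
  thus ?thesis
    using smap_alt[of id x y] by (simp add: stream.map_id)
qed

lemma word_tendsto_exists:
  assumes pre: "\<And>n. prefix (u n) (u (Suc n))" and len: "\<And>n. n < length (u n)"
  shows "\<exists>x. word_tendsto u x"
proof -
  define x where "x = smap (\<lambda>k. u k ! k) nats"
  have mono: "prefix (u m) (u n)" if "m \<le> n" for m n
    using that by (induction n rule: dec_induct) (auto intro: pre prefix_order.trans)
  have "prefix (stake k x) (u n)" if "k \<le> n" for k n
  proof -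
    have "stake k x = take k (u n)"
    proof (rule nth_equalityI)
      show "length (stake k x) = length (take k (u n))"
        using len[of n] that by simp
      fix i assume "i < length (stake k x)"
      hence i: "i < k" by simp
      have "prefix (u i) (u n)" using i that by (intro mono) simp
      hence "u n ! i = u i ! i" using len[of i] by (auto simp: prefix_def nth_append)
      thus "stake k x ! i = take k (u n) ! i"
        using i by (simp add: x_def stake_nth)
    qed
    thus ?thesis by (simp add: take_is_prefix)
  qed
  thus ?thesis unfolding word_tendsto_def by blast
qed

lemma h_omega_tendsto: "word_tendsto (\<lambda>n. (morph h_letter ^^ n) [T0]) h_omega"
proof -
  let ?u = "\<lambda>n. (morph h_letter ^^ n) [T0]"
  have pre: "prefix (?u n) (?u (Suc n))" for n
  proof (induction n)
    case 0
    show ?case by (simp add: morph_def)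
  next
    case (Suc n)
    then obtain r where r: "?u (Suc n) = ?u n @ r" by (auto simp: prefix_def)
    have "morph h_letter (?u (Suc n)) = morph h_letter (?u n) @ morph h_letter r"
      by (subst r) (simp only: morph_def map_append concat_append)
    thus ?case by simp
  qed
  have two: "2 * length w \<le> length (morph h_letter w)" for w
  proof (induction w)
    case (Cons a w)
    thus ?case by (cases a) (simp_all add: morph_def)
  qed simp
  have len: "n < length (?u n)" for n
  proof (induction n)
    case (Suc n)
    thus ?case using two[of "?u n"] by simp
  qed simp
  have "\<exists>!x. word_tendsto ?u x"
    using word_tendsto_exists[of ?u, OF pre len] word_tendsto_unique by blast
  thus ?thesis
    unfolding h_omega_def word_lim_def by (rule theI')
qed

end

theory Submission
  imports Defs "HOL-Library.Multiset"
begin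

text \<open>A word has at most as many nonempty palindromic factors as letters, and the difference is
  monotone under taking factors; so it suffices to exhibit \<open>|w|\<close> palindromes in arbitrarily long
  prefixes \<open>w\<close>. We take \<open>w = f(h\<^sup>n(0))\<close> and \<open>w = f(g(h\<^sup>n(0)))\<close>. All three morphisms have the form
  \<open>a \<mapsto> p q\<^sub>a\<close> with \<open>p\<close> and \<open>q\<^sub>a\<close> palindromes, so that \<open>u \<mapsto> \<phi>(u)p\<close> preserves palindromes. For \<open>n \<ge> 4\<close>
  the word \<open>h\<^sup>n(0)\<close> is a product \<open>P S\<close> of two palindromes and contains two further palindromes \<open>A\<close>
  and \<open>B\<close>, such that the centres of the four are \<open>0, 1, 2, 22\<close> in some order and \<open>A B\<close> lacks
  exactly one occurrence of each letter compared with \<open>P S\<close>; \<open>A\<close> stands between letters \<open>0\<close> and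
  \<open>2\<close>, and \<open>B\<close> between \<open>1\<close> and \<open>2\<close>. This is preserved by
  \<open>P \<mapsto> h(P)0\<close>, \<open>S \<mapsto> 0\<^sup>-\<^sup>1h(S)\<close>, \<open>(A, B) \<mapsto> (2h(B)02, h(A)0)\<close>. The images in the binary words,
  extended as far as the neighbouring letters allow, have the centres \<open>0, 1, 00, 11\<close> and total
  length \<open>2|w| - 2\<close>, so that their central factors are \<open>|w|\<close> distinct palindromes.\<close>

section \<open>Palindromic factors and richness\<close>

definition pal_factors :: "'a list \<Rightarrow> 'a list set" where
  "pal_factors w = {v. v \<noteq> [] \<and> palindrome v \<and> sublist v w}"

lemma finite_pal_factors: "finite (pal_factors w)"
  by (rule finite_subset[OF _ finite_set[of "sublists w"]])
    (auto simp: pal_factors_def simp flip: set_sublists_eq)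

lemma rich_iff: "rich w \<longleftrightarrow> card (pal_factors w) = length w"
  by (simp add: rich_def pal_factors_def)

lemma pal_factors_rev: "pal_factors (rev w) = pal_factors w"
proof -
  have "sublist v (rev w) \<longleftrightarrow> sublist v w" if "palindrome v" for v
    using that by (metis palindrome_def sublist_rev)
  thus ?thesis by (auto simp: pal_factors_def)
qed

text \<open>A palindromic suffix of a palindrome is also its prefix; hence at most the longest
  palindromic suffix can be new.\<close>

lemma card_pal_factors_snoc: "card (pal_factors (w @ [a])) \<le> Suc (card (pal_factors w))"
proof -
  let ?N = "pal_factors (w @ [a]) - pal_factors w"
  have shorter: False
    if uv: "u \<in> ?N" "v \<in> ?N" and less: "length u < length v" for u v
  proof -
    have suf: "suffix x (w @ [a])" if "x \<in> ?N" for x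
      using that by (auto simp: pal_factors_def sublist_snoc)
    have "suffix u v"
      using suf[OF uv(1)] suf[OF uv(2)] less by (meson less_imp_le suffix_length_suffix)
    hence "prefix u v"
      using uv by (auto simp: pal_factors_def palindrome_def suffix_to_prefix)
    then obtain z where z: "v = u @ z" by (auto simp: prefix_def)
    with less have "z \<noteq> []" by auto
    then obtain y b where y: "z = y @ [b]" by (metis rev_exhaust)
    obtain x where "w @ [a] = x @ v" using suf[OF uv(2)] by (auto simp: suffix_def)
    hence "w = x @ u @ y" using z y by simp
    hence "sublist u w" by (auto simp: sublist_def)
    thus False using uv by (auto simp: pal_factors_def)
  qed
  have "u = v" if "u \<in> ?N" "v \<in> ?N" for u v
  proof -
    have "length u = length v" using shorter that by (meson linorder_neqE_nat)
    moreover have "suffix u (w @ [a])" "suffix v (w @ [a])"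
      using that by (auto simp: pal_factors_def sublist_snoc)
    ultimately show ?thesis
      by (metis suffix_length_suffix order_refl suffix_order.antisym)
  qed
  hence "card ?N \<le> 1"
    by (metis card_le_Suc0_iff_eq finite_Diff finite_pal_factors One_nat_def)
  moreover have "card (pal_factors (w @ [a])) \<le> card (pal_factors w \<union> ?N)"
    by (intro card_mono) (auto simp: finite_pal_factors)
  ultimately show ?thesis
    using card_Un_le[of "pal_factors w" ?N] by linarith
qed

lemma card_pal_factors_append: "card (pal_factors (u @ v)) \<le> card (pal_factors u) + length v"
proof (induction v rule: rev_induct)
  case (snoc a v)
  show ?case using card_pal_factors_snoc[of "u @ v" a] snoc by simp
qed simp

text \<open>Reversal turns letters added in front into letters added at the end and keeps the
  palindromic factors.\<close>

lemma card_pal_factors_append2: "card (pal_factors (u @ v)) \<le> length u + card (pal_factors v)"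
  using card_pal_factors_append[of "rev v" "rev u"]
  by (metis add.commute length_rev pal_factors_rev rev_append)

lemma card_pal_factors_le: "card (pal_factors (w :: 'a list)) \<le> length w"
proof -
  have "pal_factors [] = ({} :: 'a list set)" by (auto simp: pal_factors_def)
  thus ?thesis using card_pal_factors_append[of "[]" w] by simp
qed

text \<open>Extending \<open>v\<close> to \<open>w\<close> adds at most one palindrome per letter,
  so a deficit in \<open>v\<close> could not be made up for in \<open>w\<close>.\<close>

lemma rich_sublist:
  assumes "length w \<le> card (pal_factors w)" "sublist v w"
  shows "rich v"
proof -
  obtain x y where w: "w = x @ v @ y" using assms(2) by (auto simp: sublist_def)
  have "length w \<le> length x + card (pal_factors v) + length y"
    using assms(1) card_pal_factors_append2[of x "v @ y"] card_pal_factors_append[of v y]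
    unfolding w by linarith
  hence "length v \<le> card (pal_factors v)" by (simp add: w)
  thus ?thesis using card_pal_factors_le[of v] by (simp add: rich_iff)
qed

section \<open>Palindromes counted by centre\<close>

definition centred :: "'a list \<Rightarrow> 'a list \<Rightarrow> bool" where
  "centred c v \<longleftrightarrow> (\<exists>u. v = rev u @ c @ u)"

lemma centred_extend: "centred c v \<Longrightarrow> centred c (rev z @ v @ z)"
  unfolding centred_def by (metis append.assoc rev_append)

text \<open>The lengths leave only one candidate for the right half, so \<open>centred\<close> can
  be decided for concrete words by evaluation.\<close>

lemma centred_iff_drop:
  "centred c v \<longleftrightarrow> v = rev (drop ((length v + length c) div 2) v) @ c
     @ drop ((length v + length c) div 2) v" (is "_ \<longleftrightarrow> ?R")
proof
  assume "centred c v"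
  then obtain u where v: "v = rev u @ c @ u" unfolding centred_def by blast
  hence "(length v + length c) div 2 = length (rev u @ c)" by simp
  hence "drop ((length v + length c) div 2) v = u" by (simp add: v)
  thus ?R using v by simp
qed (unfold centred_def, blast)

definition central_factors :: "'a list \<Rightarrow> 'a list \<Rightarrow> 'a list set" where
  "central_factors c v = {x. centred c x \<and> (\<exists>u. v = rev u @ x @ u)}"

text \<open>There is one such factor for each radius from 0 to \<open>length u\<close>; the count is
  doubled to avoid a division.\<close>

lemma card_central_factors:
  assumes "centred c v"
  shows "finite (central_factors c v)"
    and "2 * card (central_factors c v) + length c = length v + 2"
proof -
  obtain u where v: "v = rev u @ c @ u" using assms by (auto simp: centred_def)
  have eq: "central_factors c v = (\<lambda>k. rev (take k u) @ c @ take k u) ` {..length u}"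
  proof (intro equalityI subsetI)
    fix x assume "x \<in> central_factors c v"
    then obtain s t where x: "x = rev s @ c @ s" and "v = rev t @ x @ t"
      by (auto simp: central_factors_def centred_def)
    hence *: "rev u @ c @ u = (rev t @ rev s) @ c @ (s @ t)" using v by simp
    have "length u = length (s @ t)" using arg_cong[OF *, of length] by simp
    moreover have "(rev u @ c) @ u = ((rev t @ rev s) @ c) @ (s @ t)" using * by simp
    ultimately have "u = s @ t" by (metis append_eq_append_conv)
    hence "x = rev (take (length s) u) @ c @ take (length s) u" "length s \<le> length u"
      using x by auto
    thus "x \<in> (\<lambda>k. rev (take k u) @ c @ take k u) ` {..length u}" by blast
  next
    fix x assume "x \<in> (\<lambda>k. rev (take k u) @ c @ take k u) ` {..length u}"
    then obtain k where x: "x = rev (take k u) @ c @ take k u" by auto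
    have "rev u = rev (drop k u) @ rev (take k u)"
      by (metis append_take_drop_id rev_append)
    hence "v = rev (drop k u) @ x @ drop k u" by (simp add: v x)
    thus "x \<in> central_factors c v" using x unfolding central_factors_def centred_def by blast
  qed
  have "inj_on (\<lambda>k. rev (take k u) @ c @ take k u) {..length u}"
  proof (rule inj_onI)
    fix i j assume "i \<in> {..length u}" "j \<in> {..length u}"
      and "rev (take i u) @ c @ take i u = rev (take j u) @ c @ take j u"
    thus "i = j" by (auto dest!: arg_cong[of _ _ length])
  qed
  thus "finite (central_factors c v)"
    and "2 * card (central_factors c v) + length c = length v + 2"
    unfolding eq by (simp_all add: card_image v)
qed

text \<open>The parity of \<open>length x\<close> tells centres of length 1 and 2 apart. Taking two
  letters rather than the empty word as an even centre is what separates palindromes around 00 from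
  those around 11.\<close>

lemma centred_unique:
  assumes "centred c x" "centred d x" and "length c \<in> {1, 2}" "length d \<in> {1, 2}"
  shows "c = d"
proof -
  obtain s where s: "x = rev s @ c @ s" using assms(1) unfolding centred_def by blast
  obtain t where t: "x = rev t @ d @ t" using assms(2) unfolding centred_def by blast
  have "2 * length s + length c = 2 * length t + length d"
    using arg_cong[OF s, of length] arg_cong[OF t, of length] by simp
  hence "length s = length t" using assms(3,4) by (elim insertE emptyE; simp; presburger?)
  moreover have "rev s @ c @ s = rev t @ d @ t" using s t by simp
  ultimately show ?thesis by simp
qed

text \<open>Different centres make the families \<open>central_factors c v\<close> disjoint, so
  their sizes add up.\<close>

lemma sum_length_le_card_pal_factors:
  assumes cv: "\<And>c v. (c, v) \<in> set cvs \<Longrightarrow>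
      centred c v \<and> sublist v w \<and> palindrome c \<and> length c \<in> {1, 2}"
    and dist: "distinct (map fst cvs)"
  shows "(\<Sum>(c, v)\<leftarrow>cvs. length v + 2) \<le> 2 * card (pal_factors w) + (\<Sum>(c, v)\<leftarrow>cvs. length c)"
proof -
  let ?K = "\<lambda>(c, v). central_factors c v"
  have disj: "?K i \<inter> ?K j = {}" if ij: "i \<in> set cvs" "j \<in> set cvs" "i \<noteq> j" for i j
  proof (rule ccontr)
    assume "?K i \<inter> ?K j \<noteq> {}"
    then obtain x where "centred (fst i) x" "centred (fst j) x"
      by (auto simp: central_factors_def split: prod.splits)
    hence "fst i = fst j"
      using cv[of "fst i" "snd i"] cv[of "fst j" "snd j"] ij centred_unique by (metis prod.collapse)
    thus False using dist ij by (metis distinct_map inj_on_def)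
  qed
  have "(\<Sum>(c, v)\<leftarrow>cvs. length v + 2) = (\<Sum>i\<leftarrow>cvs. 2 * card (?K i) + length (fst i))"
    using cv by (intro arg_cong[where f = sum_list] map_cong refl)
      (fastforce simp: card_central_factors(2))
  also have "\<dots> = 2 * (\<Sum>i\<leftarrow>cvs. card (?K i)) + (\<Sum>(c, v)\<leftarrow>cvs. length c)"
    by (simp add: sum_list_addf sum_list_const_mult case_prod_unfold)
  also have "(\<Sum>i\<leftarrow>cvs. card (?K i)) = (\<Sum>i\<in>set cvs. card (?K i))"
    using dist by (intro sum_list_distinct_conv_sum_set) (simp add: distinct_map)
  also have "\<dots> = card (\<Union>i\<in>set cvs. ?K i)"
    using cv card_central_factors(1) disj by (intro card_UN_disjoint[symmetric]) auto
  also have "\<dots> \<le> card (pal_factors w)"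
  proof (rule card_mono[OF finite_pal_factors], rule subsetI)
    fix x assume "x \<in> (\<Union>i\<in>set cvs. ?K i)"
    then obtain c v where i: "(c, v) \<in> set cvs" and x: "x \<in> central_factors c v" by auto
    have "sublist x v" "centred c x" using x by (auto simp: central_factors_def sublist_def)
    moreover have "sublist v w" "palindrome c" "c \<noteq> []" using cv[OF i] by auto
    ultimately show "x \<in> pal_factors w"
      by (auto simp: pal_factors_def centred_def palindrome_def intro: sublist_order.order_trans)
  qed
  finally show ?thesis by simp
qed

section \<open>Morphisms of the form a \<open>\<mapsto>\<close> p q\<close>

lemma morph_simps [simp]:
  "morph \<phi> [] = []" "morph \<phi> (a # w) = \<phi> a @ morph \<phi> w"
  "morph \<phi> (u @ w) = morph \<phi> u @ morph \<phi> w"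
  by (simp_all add: morph_def)

text \<open>Class P of Hof, Knill and Simon, with the common prefix \<open>p\<close> as a
  parameter.\<close>

definition class_P :: "('a \<Rightarrow> 'b list) \<Rightarrow> 'b list \<Rightarrow> bool" where
  "class_P \<phi> p \<longleftrightarrow> palindrome p \<and> (\<forall>a. \<exists>q. palindrome q \<and> \<phi> a = p @ q)"

text \<open>Since \<open>\<phi> a @ p = p @ q @ p = p @ rev (\<phi> a)\<close>, the word
  \<open>p\<close> moves leftwards through the image, one letter of \<open>u\<close> at a
  time.\<close>

lemma class_P_rev:
  assumes "class_P \<phi> p"
  shows "morph \<phi> (rev u) @ p = p @ rev (morph \<phi> u)"
proof (induction u)
  case (Cons a u)
  obtain q where "rev q = q" "\<phi> a = p @ q" "rev p = p"
    using assms by (auto simp: class_P_def palindrome_def)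
  thus ?case using Cons by simp
qed simp

text \<open>The new centre \<open>d\<close> may need a copy of \<open>p\<close> on each side of
  \<open>c'\<close>: for \<open>f_letter\<close> and \<open>c = [T0]\<close>, the word
  \<open>c'\<close> is empty and \<open>d\<close> is 00. If \<open>v\<close> is longer than
  \<open>c\<close>, the images of its outer letters supply these copies inside \<open>x\<close>,
  which gives the last conjunct.\<close>

lemma class_P_centred:
  assumes P: "class_P \<phi> p" and c: "morph \<phi> c = p @ c'" "centred d (p @ c' @ p)"
    and "centred c v"
  shows "\<exists>x. morph \<phi> v = p @ x \<and> centred d (p @ x @ p) \<and> (length c < length v \<longrightarrow> centred d x)"
proof -
  obtain u where v: "v = rev u @ c @ u" using assms(4) unfolding centred_def by blast
  define x where "x = rev (morph \<phi> u) @ c' @ morph \<phi> u"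
  have im: "morph \<phi> v = p @ x"
    using class_P_rev[OF P, of u] c(1) unfolding v x_def by (metis append.assoc morph_simps(3))
  show ?thesis
  proof (cases u)
    case Nil
    thus ?thesis using im c(2) v by (simp add: x_def)
  next
    case (Cons a t)
    obtain y where y: "morph \<phi> u = p @ y" and "rev p = p"
      using P unfolding Cons class_P_def palindrome_def by (metis append.assoc morph_simps(2))
    hence "x = rev y @ (p @ c' @ p) @ y" "p @ x @ p = rev (y @ p) @ (p @ c' @ p) @ (y @ p)"
      by (simp_all add: x_def)
    thus ?thesis using im centred_extend[OF c(2)] by metis
  qed
qed

section \<open>Four palindromes in the iterates of h\<close>

text \<open>A multiset, because applying h permutes the centres among the four palindromes.\<close>

definition ctrs :: "tern list multiset" where
  "ctrs = {#[T0], [T1], [T2], [T2, T2]#}"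

text \<open>The word \<open>t\<close> must be nonempty because the image of \<open>y\<close> alone can be too short for the
  extension of the image of \<open>v\<close>. In \<open>frame\<close>, the condition \<open>3 \<le> length S\<close> makes \<open>S\<close> longer than its
  centre, so that cutting \<open>0\<close> off \<open>h(S)\<close> does not cut the new centre.\<close>

definition flanked :: "'a set \<Rightarrow> 'a list \<Rightarrow> 'a list \<Rightarrow> bool" where
  "flanked L v w \<longleftrightarrow> (\<exists>r x y t. w = r @ x # v @ y # t \<and> {x, y} = L \<and> t \<noteq> [])"

inductive frame :: "tern list \<Rightarrow> bool" where
  frameI: "frame (P @ S)"
  if "{#c, d, a, b#} = ctrs"
    and "centred c P" "centred d S" "centred a A" "centred b B" and "3 \<le> length S"
    and "\<forall>l. count_list A l + count_list B l + 1 = count_list (P @ S) l"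
    and "flanked {T0, T2} A (P @ S)" "flanked {T1, T2} B (P @ S)"

lemma class_P_h: "class_P h_letter [T0]"
  unfolding class_P_def
proof (intro conjI allI)
  show "\<exists>q. palindrome q \<and> h_letter a = [T0] @ q" for a
    by (cases a) (auto simp: palindrome_def)
qed (simp add: palindrome_def)

text \<open>On \<open>ctrs\<close> this is the cycle 0, 1, 2, 22, 0; the last branch serves 22, as
  h(22)0 = 0220220 has the middle letter 0.\<close>

definition h_ctr :: "tern list \<Rightarrow> tern list" where
  "h_ctr c = (if c = [T0] then [T1] else if c = [T1] then [T2] else
     if c = [T2] then [T2, T2] else [T0])"

lemma h_centred:
  assumes "c \<in># ctrs" "centred c v"
  shows "\<exists>x. morph h_letter v = T0 # x \<and> centred (h_ctr c) (T0 # x @ [T0]) \<and>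
    (3 \<le> length v \<longrightarrow> centred (h_ctr c) x)"
proof -
  have "\<exists>c'. morph h_letter c = [T0] @ c' \<and> centred (h_ctr c) ([T0] @ c' @ [T0])"
    using assms(1) by (auto simp: ctrs_def h_ctr_def centred_iff_drop)
  moreover have "length c < 3" using assms(1) by (auto simp: ctrs_def)
  ultimately show ?thesis using class_P_centred[OF class_P_h _ _ assms(2)] by fastforce
qed

lemma count_list_h:
  "count_list (morph h_letter w) l = (case l of
     T0 \<Rightarrow> count_list w T0 + count_list w T1 + count_list w T2 |
     T1 \<Rightarrow> count_list w T0 | T2 \<Rightarrow> count_list w T1 + 2 * count_list w T2)"
proof (induction w)
  case (Cons a w)
  thus ?case by (cases a; cases l) simp_all
qed (cases l; simp)

lemma length_h: "2 * length w \<le> length (morph h_letter w)"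
proof (induction w)
  case (Cons a w)
  thus ?case by (cases a) simp_all
qed simp

text \<open>The images of 1 and 2 share the start 02 and the end 2, so that of \<open>B\<close>
  grows to 2h(B)02; the images of 0 and 2 share the start 0 but end in 1 and 2, so that of
  \<open>A\<close> grows only to h(A)0. The letters where the neighbours first differ are the new
  flanks, and the two roles swap.\<close>

lemma frame_h:
  assumes "frame w"
  shows "frame (morph h_letter w)"
proof -
  obtain P S A B c d a b where w: "w = P @ S" and ctr: "{#c, d, a, b#} = ctrs"
    and cen: "centred c P" "centred d S" "centred a A" "centred b B"
    and len_S: "3 \<le> length S"
    and cnt: "\<forall>l. count_list A l + count_list B l + 1 = count_list w l"
    and A: "flanked {T0, T2} A w" and B: "flanked {T1, T2} B w"
    using assms by cases (rule that; simp)
  have mem: "c \<in># ctrs" "d \<in># ctrs" "a \<in># ctrs" "b \<in># ctrs"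
    by (simp_all flip: ctr)
  obtain P' where P': "morph h_letter P = T0 # P'" "centred (h_ctr c) (T0 # P' @ [T0])"
    using h_centred[OF mem(1) cen(1)] by blast
  obtain S' where S': "morph h_letter S = T0 # S'" "centred (h_ctr d) S'"
    using h_centred[OF mem(2) cen(2)] len_S by blast
  obtain A' where A': "morph h_letter A = T0 # A'" "centred (h_ctr a) (T0 # A' @ [T0])"
    using h_centred[OF mem(3) cen(3)] by blast
  obtain B' where B': "morph h_letter B = T0 # B'" "centred (h_ctr b) (T0 # B' @ [T0])"
    using h_centred[OF mem(4) cen(4)] by blast
  note im = P'(1) S'(1) A'(1) B'(1) and cen' = P'(2) S'(2) A'(2) B'(2)
  have ctr': "{#h_ctr c, h_ctr d, h_ctr b, h_ctr a#} = ctrs"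
    using arg_cong[OF ctr, of "image_mset h_ctr"]
    by (simp add: ctrs_def h_ctr_def add_mset_commute)
  have A'': "flanked {T0, T2} (T2 # T0 # B' @ [T0, T2]) (morph h_letter w)"
  proof -
    obtain r x y z t where B: "w = r @ x # B @ y # z # t" "{x, y} = {T1, T2}"
      using B unfolding flanked_def by (metis neq_Nil_conv)
    then consider "x = T1" "y = T2" | "x = T2" "y = T1" by (auto simp: doubleton_eq_iff)
    thus ?thesis
    proof cases
      case 1
      thus ?thesis unfolding flanked_def using B im
        by (intro exI[of _ "morph h_letter r"] exI[of _ T0] exI[of _ T2]
              exI[of _ "morph h_letter (z # t)"]) (cases z; simp)
    next
      case 2
      \<comment> \<open>The right neighbour 0 is the first letter of \<open>h_letter z\<close>; the
        rest of that block keeps the remaining suffix nonempty.\<close>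
      thus ?thesis unfolding flanked_def using B im
        by (intro exI[of _ "morph h_letter r @ [T0]"] exI[of _ T2] exI[of _ T0]
              exI[of _ "tl (morph h_letter (z # t))"]) (cases z; simp add: insert_commute)
    qed
  qed
  have B'': "flanked {T1, T2} (T0 # A' @ [T0]) (morph h_letter w)"
  proof -
    obtain r x y z t where A: "w = r @ x # A @ y # z # t" "{x, y} = {T0, T2}"
      using A unfolding flanked_def by (metis neq_Nil_conv)
    then consider "x = T0" "y = T2" | "x = T2" "y = T0" by (auto simp: doubleton_eq_iff)
    thus ?thesis
    proof cases
      case 1
      thus ?thesis unfolding flanked_def using A im
        by (intro exI[of _ "morph h_letter r @ [T0]"] exI[of _ T1] exI[of _ T2]
              exI[of _ "T2 # morph h_letter (z # t)"]) simp
    next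
      case 2
      thus ?thesis unfolding flanked_def using A im
        by (intro exI[of _ "morph h_letter r @ [T0, T2]"] exI[of _ T2] exI[of _ T1]
              exI[of _ "morph h_letter (z # t)"]) (cases z; simp add: insert_commute)
    qed
  qed
  \<comment> \<open>The images of the three missing letters contain 0, 1, 2 with multiplicities 3,
    1, 3; the extensions use up 2, 0, 2 of these, so one of each is missing again.\<close>
  have cnt': "count_list (T2 # T0 # B' @ [T0, T2]) l + count_list (T0 # A' @ [T0]) l + 1
      = count_list (morph h_letter w) l" for l
    using cnt[rule_format, of T0] cnt[rule_format, of T1] cnt[rule_format, of T2]
      count_list_h[of A l] count_list_h[of B l] count_list_h[of w l]
    unfolding im by (cases l) simp_all
  have w': "morph h_letter w = (T0 # P' @ [T0]) @ S'" using w im by simp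
  show ?thesis
    unfolding w'
  proof (rule frameI[OF ctr'])
    show "centred (h_ctr b) (T2 # T0 # B' @ [T0, T2])"
      using centred_extend[OF cen'(4), of "[T2]"] by simp
    show "3 \<le> length S'" using length_h[of S] len_S im(2) by simp
  qed (use cen' cnt' A'' B'' w' in \<open>simp_all only: simp_thms\<close>)
qed

lemma frame_h_power: "frame ((morph h_letter ^^ (n + 4)) [T0])"
proof (induction n)
  case 0
  let ?w = "[T0,T1,T0,T2,T0,T1,T0,T2,T2,T0,T1,T0,T2,T0,T1,T0,T2,T2,T0,T2,T2]"
  have w: "(morph h_letter ^^ (0 + 4)) [T0] = ?w"
    by (simp add: eval_nat_numeral)
  \<comment> \<open>The cut after 16 letters splits the word into 0102010 22 0102010 and 22 0
    22.\<close>
  have "frame (take 16 ?w @ drop 16 ?w)"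
  proof (rule frameI)
    show "{#[T2, T2], [T0], [T1], [T2]#} = ctrs" by (simp add: ctrs_def add_mset_commute)
    show "centred [T2, T2] (take 16 ?w)" "centred [T0] (drop 16 ?w)"
      "centred [T1] [T2,T0,T1,T0,T2]"
      "centred [T2] [T0,T2,T2,T0,T1,T0,T2,T0,T1,T0,T2,T2,T0]"
      by (simp_all add: centred_iff_drop)
    show "3 \<le> length (drop 16 ?w)" by simp
    show "\<forall>l. count_list [T2,T0,T1,T0,T2] l + count_list [T0,T2,T2,T0,T1,T0,T2,T0,T1,T0,T2,T2,T0] l
        + 1 = count_list (take 16 ?w @ drop 16 ?w) l"
    proof
      fix l
      show "count_list [T2,T0,T1,T0,T2] l + count_list [T0,T2,T2,T0,T1,T0,T2,T0,T1,T0,T2,T2,T0] l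
        + 1 = count_list (take 16 ?w @ drop 16 ?w) l" by (cases l) simp_all
    qed
    show "flanked {T0, T2} [T2,T0,T1,T0,T2] (take 16 ?w @ drop 16 ?w)"
      unfolding flanked_def append_take_drop_id
      by (intro exI[of _ "[T0,T1]"] exI[of _ T0] exI[of _ T2]
          exI[of _ "[T0,T1,T0,T2,T0,T1,T0,T2,T2,T0,T2,T2]"]) simp
    show "flanked {T1, T2} [T0,T2,T2,T0,T1,T0,T2,T0,T1,T0,T2,T2,T0] (take 16 ?w @ drop 16 ?w)"
      unfolding flanked_def append_take_drop_id
      by (intro exI[of _ "[T0,T1,T0,T2,T0]"] exI[of _ T1] exI[of _ T2] exI[of _ "[T2]"]) simp
  qed
  thus ?case unfolding w append_take_drop_id .
next
  case (Suc n)
  show ?case using frame_h[OF Suc] by (simp only: add_Suc funpow.simps comp_apply)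
qed

section \<open>Binary images\<close>

text \<open>The images of the inner palindromes are extended on both sides by \<open>zA\<close> and \<open>zB\<close>, as far as
  the two possible neighbours agree.\<close>

lemma frame_image:
  fixes \<phi> :: "tern \<Rightarrow> bin list"
  assumes "frame w" and P: "class_P \<phi> p"
    and ctr_image: "image_mset k ctrs = {#[B0], [B1], [B0, B0], [B1, B1]#}"
    and img: "\<And>c. c \<in># ctrs \<Longrightarrow> \<exists>c'. morph \<phi> c = p @ c' \<and> centred (k c) (p @ c' @ p)"
    and zA: "\<And>x z. x \<in> {T0, T2} \<Longrightarrow> suffix (rev zA) (\<phi> x) \<and> prefix (p @ zA) (\<phi> x @ \<phi> z)"
    and zB: "\<And>x z. x \<in> {T1, T2} \<Longrightarrow> suffix (rev zB) (\<phi> x) \<and> prefix (p @ zB) (\<phi> x @ \<phi> z)"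
    and len: "length (\<phi> T0) + length (\<phi> T1) + length (\<phi> T2)
      = 2 * (length p + length zA + length zB) + 2"
  shows "length (morph \<phi> w) \<le> card (pal_factors (morph \<phi> w))"
proof -
  obtain P S A B c d a b where w: "w = P @ S" and ctr: "{#c, d, a, b#} = ctrs"
    and cen: "centred c P" "centred d S" "centred a A" "centred b B"
    and len_S: "3 \<le> length S"
    and cnt: "\<forall>l. count_list A l + count_list B l + 1 = count_list w l"
    and A: "flanked {T0, T2} A w" and B: "flanked {T1, T2} B w"
    using \<open>frame w\<close> by cases (rule that; simp)
  have mem: "c \<in># ctrs" "d \<in># ctrs" "a \<in># ctrs" "b \<in># ctrs"
    by (simp_all flip: ctr)
  have image: "\<exists>x. morph \<phi> v = p @ x \<and> centred (k c) (p @ x @ p) \<and>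
      (length c < length v \<longrightarrow> centred (k c) x)" if "c \<in># ctrs" "centred c v" for c v
    using img[OF that(1)] class_P_centred[OF P _ _ that(2)] by fast
  have "length d < length S" using mem(2) len_S by (auto simp: ctrs_def)
  obtain P' where P': "morph \<phi> P = p @ P'" "centred (k c) (p @ P' @ p)"
    using image[OF mem(1) cen(1)] by blast
  obtain S' where S': "morph \<phi> S = p @ S'" "centred (k d) S'"
    using image[OF mem(2) cen(2)] \<open>length d < length S\<close> by blast
  obtain A' where A': "morph \<phi> A = p @ A'" "centred (k a) (p @ A' @ p)"
    using image[OF mem(3) cen(3)] by blast
  obtain B' where B': "morph \<phi> B = p @ B'" "centred (k b) (p @ B' @ p)"
    using image[OF mem(4) cen(4)] by blast
  note im = P'(1) S'(1) A'(1) B'(1) and cen' = P'(2) S'(2) A'(2) B'(2)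
  have inner: "sublist (rev z @ p @ X' @ p @ z) (morph \<phi> w)"
    if X: "flanked L X w" "morph \<phi> X = p @ X'"
      and z: "\<And>x l. x \<in> L \<Longrightarrow> suffix (rev z) (\<phi> x) \<and> prefix (p @ z) (\<phi> x @ \<phi> l)"
    for X X' z L
  proof -
    obtain r x y l t where eq: "w = r @ x # X @ y # l # t" and "{x, y} = L"
      using X(1) unfolding flanked_def by (metis neq_Nil_conv)
    hence L: "x \<in> L" "y \<in> L" by auto
    obtain u v where "\<phi> x = u @ rev z" "\<phi> y @ \<phi> l = (p @ z) @ v"
      using z[OF L(1), of l] z[OF L(2), of l] by (auto simp: suffix_def prefix_def)
    hence "morph \<phi> w = (morph \<phi> r @ u) @ (rev z @ p @ X' @ p @ z) @ (v @ morph \<phi> t)"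
      using eq X(2) by simp
    thus ?thesis unfolding sublist_def by blast
  qed
  let ?cvs = "[(k c, p @ P' @ p), (k d, S'), (k a, rev zA @ p @ A' @ p @ zA),
    (k b, rev zB @ p @ B' @ p @ zB)]"
  \<comment> \<open>Which palindrome has which binary centre is unknown, so distinctness and total
    length of the centres are read off the multiset.\<close>
  have ms: "mset (map fst ?cvs) = mset [[B0], [B1], [B0, B0], [B1, B1]]"
    using ctr_image unfolding ctr[symmetric] by simp
  have "k c' \<in> {[B0], [B1], [B0, B0], [B1, B1]}" if "c' \<in># ctrs" for c'
  proof -
    have "k c' \<in># image_mset k ctrs" using that by simp
    thus ?thesis unfolding ctr_image by simp
  qed
  hence "palindrome (k c') \<and> length (k c') \<in> {1, 2}" if "c' \<in># ctrs" for c'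
    using that by (force simp: palindrome_def)
  note ok = mem[THEN this]
  have dist: "distinct (map fst ?cvs)"
    unfolding mset_eq_imp_distinct_iff[OF ms] by simp
  have "sum_mset (image_mset length (mset (map fst ?cvs))) = 6"
    by (subst ms) simp
  hence len_ctr: "length (k c) + length (k d) + length (k a) + length (k b) = 6" by simp
  have split: "morph \<phi> w = [] @ (p @ P' @ p) @ S'" "morph \<phi> w = (p @ P' @ p) @ S' @ []"
    by (simp_all add: w im)
  have "sublist (p @ P' @ p) (morph \<phi> w)" "sublist S' (morph \<phi> w)"
    unfolding sublist_def using split by blast+
  moreover have "centred (k a) (rev zA @ p @ A' @ p @ zA)"
    using centred_extend[OF cen'(3), of zA] by simp
  moreover have "centred (k b) (rev zB @ p @ B' @ p @ zB)"
    using centred_extend[OF cen'(4), of zB] by simp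
  moreover have "sublist (rev zA @ p @ A' @ p @ zA) (morph \<phi> w)"
    by (rule inner[OF A im(3) zA])
  moreover have "sublist (rev zB @ p @ B' @ p @ zB) (morph \<phi> w)"
    by (rule inner[OF B im(4) zB])
  moreover note cen'(1,2)
  ultimately have good: "centred c' v \<and> sublist v (morph \<phi> w) \<and> palindrome c' \<and> length c' \<in> {1, 2}"
    if "(c', v) \<in> set ?cvs" for c' v
    using that ok unfolding list.set insert_iff empty_iff prod.inject by (elim disjE; simp only: simp_thms)
  have "(\<Sum>(c, v)\<leftarrow>?cvs. length v + 2)
      \<le> 2 * card (pal_factors (morph \<phi> w)) + (\<Sum>(c, v)\<leftarrow>?cvs. length c)"
    by (rule sum_length_le_card_pal_factors[OF good dist])
  hence "length (p @ P' @ p) + length S' + length (rev zA @ p @ A' @ p @ zA)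
      + length (rev zB @ p @ B' @ p @ zB) + 2 \<le> 2 * card (pal_factors (morph \<phi> w))"
    using len_ctr by simp
  moreover have "length (morph \<phi> w) = length (morph \<phi> A) + length (morph \<phi> B)
      + length (\<phi> T0) + length (\<phi> T1) + length (\<phi> T2)"
  proof -
    have length_morph: "length (morph \<phi> u) = count_list u T0 * length (\<phi> T0)
      + count_list u T1 * length (\<phi> T1) + count_list u T2 * length (\<phi> T2)" for u
    proof (induction u)
      case (Cons l u)
      thus ?case by (cases l) simp_all
    qed simp
    show ?thesis
      unfolding length_morph cnt[rule_format, symmetric] by (simp add: algebra_simps)
  qed
  moreover have "length (morph \<phi> w) = length (morph \<phi> P) + length (morph \<phi> S)"
    by (simp add: w)
  \<comment> \<open>The two outer palindromes have total length
    \<open>length (morph \<phi> w)\<close>; by \<open>len\<close> the two inner ones have 2 less,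
    which the summand 2 above makes up for.\<close>
  ultimately show ?thesis
    using len unfolding im length_append length_rev distrib_left by presburger
qed

text \<open>The images of 1 and 2 both start with 01 and end with 1, whence \<open>zB\<close>; those
  of 0 and 2 end in different letters, so \<open>zA\<close> is empty. The length condition reads 1 +
  2 + 3 = 2(1 + 0 + 1) + 2.\<close>

lemma f_image_rich:
  assumes "frame w"
  shows "length (morph f_letter w) \<le> card (pal_factors (morph f_letter w))"
proof (rule frame_image[OF assms, where p = "[B0]" and zA = "[]" and zB = "[B1]"
      and k = "\<lambda>c. if c = [T0] then [B0, B0] else if c = [T1] then [B1]
        else if c = [T2] then [B1, B1] else [B0]"], goal_cases)
  case 1
  have "\<exists>q. palindrome q \<and> f_letter a = [B0] @ q" for a
    by (cases a) (auto simp: palindrome_def)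
  thus ?case by (simp add: class_P_def palindrome_def)
next
  case 2
  show ?case by (simp add: ctrs_def add_mset_commute)
next
  case (3 c)
  thus ?case
    by (auto simp: ctrs_def centred_iff_drop)
next
  case (4 x z)
  thus ?case by auto
next
  case (5 x z)
  thus ?case by (cases z) (auto simp: suffix_def)
qed simp

text \<open>The composition is again of class P, with \<open>p\<close> = 00, and is treated as a
  single morphism.\<close>

lemma f_g_image_rich:
  assumes "frame w"
  shows "length (morph f_letter (morph g_letter w))
    \<le> card (pal_factors (morph f_letter (morph g_letter w)))"
proof -
  define fg where "fg a = morph f_letter (g_letter a)" for a
  have fg: "fg T0 = [B0,B0,B1,B0,B1]" "fg T1 = [B0,B0,B1,B0,B1,B1,B0,B1]"
    "fg T2 = [B0,B0,B1,B0,B1,B1,B0,B1,B0,B1,B1,B0,B1]"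
    by (simp_all add: fg_def)
  have "length (morph fg w) \<le> card (pal_factors (morph fg w))"
  \<comment> \<open>Here \<open>p @ zB\<close> has 9 letters and \<open>fg T1\<close> only 8; the
    last letter is the initial 0 of the next image. The lengths satisfy 5 + 8 + 13 = 2(2 + 3 + 7) +
    2.\<close>
  proof (rule frame_image[OF assms, where p = "[B0, B0]" and zA = "[B1, B0, B1]"
        and zB = "[B1, B0, B1, B1, B0, B1, B0]"
        and k = "\<lambda>c. if c = [T0] then [B0] else if c = [T1] then [B1, B1]
          else if c = [T2] then [B1] else [B0, B0]"], goal_cases)
    case 1
    have "\<exists>q. palindrome q \<and> fg a = [B0, B0] @ q" for a
      by (cases a) (auto simp: palindrome_def fg)
    thus ?case by (simp add: class_P_def palindrome_def)
  next
    case 2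
    show ?case by (simp add: ctrs_def add_mset_commute)
  next
    case (3 c)
    thus ?case
      by (auto simp: ctrs_def fg centred_iff_drop)
  next
    case (4 x z)
    thus ?case by (auto simp: fg suffix_def)
  next
    case (5 x z)
    thus ?case by (cases z) (auto simp: fg suffix_def)
  qed (simp add: fg)
  moreover have "morph fg u = morph f_letter (morph g_letter u)" for u
    by (induction u) (simp_all add: fg_def)
  ultimately show ?thesis by simp
qed

section \<open>Infinite words\<close>

lemma morph_inf_shift:
  assumes "\<And>a. \<phi> a \<noteq> []"
  shows "morph_inf \<phi> (w @- x) = morph \<phi> w @- morph_inf \<phi> x"
  unfolding morph_inf_def by (induction w) (simp_all add: assms)

lemma length_le_morph:
  assumes "\<And>a. \<phi> a \<noteq> []"
  shows "length w \<le> length (morph \<phi> w)"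
proof (induction w)
  case (Cons a w)
  have "0 < length (\<phi> a)" using assms by simp
  thus ?case using Cons unfolding morph_simps length_append list.size by linarith
qed simp

text \<open>The factor of length \<open>n\<close> at position \<open>i\<close> lies inside any
  prefix of length at least \<open>i + n\<close>, from which it inherits richness.\<close>

lemma rich_infI:
  assumes "\<And>n. \<exists>w y. x = w @- y \<and> n \<le> length w \<and> length w \<le> card (pal_factors w)"
  shows "rich_inf x"
  unfolding rich_inf_def factor_inf_def
proof (intro allI impI)
  fix v assume "\<exists>i n. v = stake n (sdrop i x)"
  then obtain i n where v: "v = stake n (sdrop i x)" by blast
  obtain w y where x: "x = w @- y" and n: "i + n \<le> length w"
    and rich: "length w \<le> card (pal_factors w)"
    using assms by blast
  have "v = take n (drop i w)"
    using n by (simp add: v x sdrop_shift stake_shift)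
  hence "sublist v w"
    by (metis sublist_drop sublist_take sublist_order.order_trans)
  thus "rich v" by (rule rich_sublist[OF rich])
qed

lemma h_omega_prefix: "\<exists>y. h_omega = (morph h_letter ^^ n) [T0] @- y"
proof -
  let ?u = "\<lambda>n. (morph h_letter ^^ n) [T0]"
  have mono: "prefix (?u n) (?u (n + m))" for n m
  proof (induction n)
    case 0
    show ?case
    proof (induction m)
      case (Suc m)
      then obtain r where "?u m = T0 # r" by (auto simp: prefix_def)
      thus ?case by simp
    qed simp
  next
    case (Suc n)
    then obtain r where "?u (n + m) = ?u n @ r" by (auto simp: prefix_def)
    thus ?case by simp
  qed
  \<comment> \<open>A late iterate starts both with \<open>?u n\<close> and with the prefix of
    \<open>h_omega\<close> of the same length, so these two coincide.\<close>
  obtain N where "\<forall>m\<ge>N. prefix (stake (length (?u n)) h_omega) (?u m)"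
    using h_omega_tendsto unfolding word_tendsto_def by blast
  hence "prefix (stake (length (?u n)) h_omega) (?u (n + N))" by simp
  hence "stake (length (?u n)) h_omega = ?u n"
    using mono[of n N]
    by (metis length_stake order_refl prefix_length_prefix prefix_order.antisym)
  thus ?thesis by (metis stake_sdrop)
qed

lemma h_omega_framed_prefix:
  "\<exists>w y. h_omega = w @- y \<and> n \<le> length w \<and> frame w"
proof -
  have step: "length w < length (morph h_letter w)" if "0 < length w" for w
    using that length_h[of w] by linarith
  have "n < length ((morph h_letter ^^ n) [T0])" for n
  proof (induction n)
    case (Suc n)
    hence "0 < length ((morph h_letter ^^ n) [T0])" by (rule le_less_trans[rotated]) simp
    from step[OF this] Suc show ?case unfolding funpow.simps comp_apply by linarith
  qed simp
  from this[of "n + 4"] show ?thesis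
    using h_omega_prefix[of "n + 4"] frame_h_power[of n] by (meson add_leD1 less_imp_le)
qed

theorem theorem15:
  shows "rich_inf (morph_inf f_letter h_omega) \<and>
         rich_inf (morph_inf f_letter (morph_inf g_letter h_omega))"
proof (intro conjI rich_infI)
  fix n
  obtain w y where w: "h_omega = w @- y" "n \<le> length w" "frame w"
    using h_omega_framed_prefix by blast
  have le: "length u \<le> length (morph f_letter u)" "length u \<le> length (morph g_letter u)" for u
    using letters_nonempty by (blast intro: length_le_morph)+
  have "morph_inf f_letter h_omega = morph f_letter w @- morph_inf f_letter y"
    by (simp add: w(1) morph_inf_shift letters_nonempty)
  moreover have "n \<le> length (morph f_letter w)" using w(2) le(1)[of w] by simp
  ultimately show "\<exists>w y. morph_inf f_letter h_omega = w @- y \<and> n \<le> length w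
      \<and> length w \<le> card (pal_factors w)"
    using f_image_rich[OF w(3)] by blast
  have "morph_inf f_letter (morph_inf g_letter h_omega)
      = morph f_letter (morph g_letter w) @- morph_inf f_letter (morph_inf g_letter y)"
    by (simp add: w(1) morph_inf_shift letters_nonempty)
  moreover have "n \<le> length (morph f_letter (morph g_letter w))"
    using w(2) le(2)[of w] le(1)[of "morph g_letter w"] by simp
  ultimately show "\<exists>w y. morph_inf f_letter (morph_inf g_letter h_omega) = w @- y
      \<and> n \<le> length w \<and> length w \<le> card (pal_factors w)"
    using f_g_image_rich[OF w(3)] by blast
qed

end
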